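(* Let $X\subseteq\mathbb{R}^d$ be nonempty, closed and convex, let $f\colon\mathbb{R}^d\to\mathbb{R}$ be convex (not necessarily smooth), and let $\mathbf{x}^\star\in X$ be a minimizer of $f$ over $X$. Let $\mathbf{x}_0$ be a given initial point, and let $\widetilde{\nabla}f$ be a stochastic oracle satisfying, for all $\mathbf{x}\in\mathbb{R}^d$, $$\mathbb{E}[\widetilde{\nabla} f(\mathbf{x})]\in\partial f(\mathbf{x}),\qquad \mathbb{E}\|\widetilde{\nabla} f(\mathbf{x})\|^2\le B^2\|\mathbf{x}-\mathbf{x}_0\|^2+G^2,$$ with finite constants $B>0$, $G\ge 0$. Let $\{\mathbf{x}_k\}$ be generated for $k\ge 0$ by $$\mathbf{x}_{k+1}=P_X\big(\beta_k\mathbf{x}_0+(1-\beta_k)\mathbf{x}_k-\tau_k\widetilde{\nabla}f(\mathbf{x}_k)\big),\qquad \beta_k=\frac{1}{k+2},\quad \tau_k=\frac{\sqrt{k+1}}{\sqrt{6}\,B\,(k+2)}.$$ Then for any $k\ge 1$, for $$\mathbf{x}_k^{\mathsf{out}}=\frac{1}{\sum_{i=0}^k (i+2)\tau_i}\sum_{i=0}^k (i+2)\tau_i\mathbf{x}_i=\frac{1}{\sum_{i=0}^k\sqrt{i+1}}\sum_{i=0}^k\sqrt{i+1}\,\mathbf{x}_i,$$ we have $$\mathbb{E}\big[f(\mathbf{x}_k^{\mathsf{out}})-f(\mathbf{x}^\star)\big]\le\frac{1}{\sqrt{k+1}}\left(3B\|\mathbf{x}_0-\mathbf{x}^\star\|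^2+\frac{2G^2}{3B}\right).$$
   Context: $\|\cdot\|$ is the Euclidean norm, $\partial f$ the convex subdifferential, and $P_X(\mathbf{x})=\arg\min_{\mathbf{y}\in X}\|\mathbf{y}-\mathbf{x}\|^2$ the Euclidean projection. The initial point $\mathbf{x}_0$ is deterministic. At each iteration the oracle is called with fresh randomness independent of the past; thus, with $\mathbb{E}_k$ the expectation conditioned on the $\sigma$-algebra generated by $\mathbf{x}_1,\dots,\mathbf{x}_k$, one has $\mathbb{E}_k[\widetilde{\nabla}f(\mathbf{x}_k)]\in\partial f(\mathbf{x}_k)$ and $\mathbb{E}_k\|\widetilde{\nabla}f(\mathbf{x}_k)\|^2\le B^2\|\mathbf{x}_k-\mathbf{x}_0\|^2+G^2$. *)

theory Defs
  imports "HOL-Probability.Probability"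
begin

definition subdifferential :: "('a::real_inner \<Rightarrow> real) \<Rightarrow> 'a \<Rightarrow> 'a set" where
  "subdifferential f x = {v. \<forall>y. f y \<ge> f x + v \<bullet> (y - x)}"

text \<open>
  A stochastic oracle is a map \<open>g\<close>: the answer at the query point \<open>x\<close> is \<open>g x s\<close>, where the
  randomness \<open>s\<close> is drawn from the probability space \<open>N\<close>. Joint measurability makes the answer
  at a random query point a random vector. The second moment is an \<open>ennreal\<close>-valued integral, so
  the bound includes its finiteness and hence the integrability of \<open>g x\<close>; the Bochner integral
  in the third conjunct is therefore the genuine mean.
\<close>

definition stochastic_oracle ::
  "('a::euclidean_space \<Rightarrow> real) \<Rightarrow> 'a \<Rightarrow> real \<Rightarrow> real \<Rightarrow> 's measure \<Rightarrow> ('a \<Rightarrow> 's \<Rightarrow> 'a) \<Rightarrow> bool" where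
  "stochastic_oracle f x0 B G N g \<longleftrightarrow>
     prob_space N \<and>
     (\<lambda>(x, s). g x s) \<in> borel_measurable (borel \<Otimes>\<^sub>M N) \<and>
     (\<forall>x. (\<integral>s. g x s \<partial>N) \<in> subdifferential f x) \<and>
     (\<forall>x. (\<integral>\<^sup>+ s. ennreal ((norm (g x s))\<^sup>2) \<partial>N) \<le> ennreal (B\<^sup>2 * (norm (x - x0))\<^sup>2 + G\<^sup>2))"

text \<open>
  \<open>\<xi> k\<close> is the randomness used by the oracle call in iteration \<open>k\<close>: all calls are independent
  and follow the law of the oracle.
\<close>

definition fresh_randomness :: "'w measure \<Rightarrow> 's measure \<Rightarrow> (nat \<Rightarrow> 'w \<Rightarrow> 's) \<Rightarrow> bool" where
  "fresh_randomness M N \<xi> \<longleftrightarrow>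
     prob_space.indep_vars M (\<lambda>_. N) \<xi> UNIV \<and> (\<forall>k. distr M N (\<xi> k) = N)"

definition anchor_weight :: "nat \<Rightarrow> real" where
  "anchor_weight k = 1 / (real k + 2)"

definition step_size :: "real \<Rightarrow> nat \<Rightarrow> real" where
  "step_size B k = sqrt (real k + 1) / (sqrt 6 * B * (real k + 2))"

primrec iterate ::
  "'a::euclidean_space set \<Rightarrow> real \<Rightarrow> 'a \<Rightarrow> ('a \<Rightarrow> 's \<Rightarrow> 'a) \<Rightarrow> (nat \<Rightarrow> 'w \<Rightarrow> 's) \<Rightarrow> nat \<Rightarrow> 'w \<Rightarrow> 'a" where
  "iterate X B x0 g \<xi> 0 \<omega> = x0"
| "iterate X B x0 g \<xi> (Suc k) \<omega> =
     closest_point X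
       (anchor_weight k *\<^sub>R x0 + (1 - anchor_weight k) *\<^sub>R iterate X B x0 g \<xi> k \<omega>
        - step_size B k *\<^sub>R g (iterate X B x0 g \<xi> k \<omega>) (\<xi> k \<omega>))"

definition output_point ::
  "'a::euclidean_space set \<Rightarrow> real \<Rightarrow> 'a \<Rightarrow> ('a \<Rightarrow> 's \<Rightarrow> 'a) \<Rightarrow> (nat \<Rightarrow> 'w \<Rightarrow> 's) \<Rightarrow> nat \<Rightarrow> 'w \<Rightarrow> 'a" where
  "output_point X B x0 g \<xi> k \<omega> =
     (1 / (\<Sum>i=0..k. (real i + 2) * step_size B i)) *\<^sub>R
       (\<Sum>i=0..k. ((real i + 2) * step_size B i) *\<^sub>R iterate X B x0 g \<xi> i \<omega>)"

end

theory Submission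
  imports Defs
begin

text \<open>
  Fix a point \<open>z \<in> X\<close> and write \<open>D = \<parallel>x0 - z\<parallel>\<^sup>2\<close>, \<open>a i = E \<parallel>x i - z\<parallel>\<^sup>2\<close> and
  \<open>e i = E (f (x i) - f z)\<close>. Projection onto \<open>X\<close> does not increase the distance to \<open>z\<close>, so the
  square of \<open>\<parallel>x (i+1) - z\<parallel>\<close> is bounded by expanding the unprojected step. Averaging towards the
  anchor \<open>x0\<close> with weight \<open>\<beta>\<close> produces the negative term \<open>- \<beta> (1 - \<beta>) \<parallel>x i - x0\<parallel>\<^sup>2\<close>, and this
  term pays for the part of the oracle's second moment that grows like \<open>B\<^sup>2 \<parallel>x i - x0\<parallel>\<^sup>2\<close>.
  The anchor also changes
  the inner product with the oracle answer from \<open>x i - z\<close> to \<open>x i - z - \<beta> (x i - x0)\<close>; the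
  additional part is absorbed by Young's inequality with equal weights, at the price of a second
  \<open>\<tau>\<^sup>2 \<parallel>g\<parallel>\<^sup>2\<close> and of \<open>\<beta>\<^sup>2 \<parallel>x i - x0\<parallel>\<^sup>2\<close>. With the prescribed parameters the total coefficient
  of \<open>\<parallel>x i - x0\<parallel>\<^sup>2\<close> is nonpositive for \<open>i \<ge> 1\<close>. It is positive for \<open>i = 0\<close>, but the first
  iterate is the anchor itself and the term vanishes.

  Multiplying by \<open>i + 2\<close> gives the telescoping recursion
  \<open>(i + 2) a (i+1) \<le> D + (i + 1) a i - 2 (i + 2) \<tau> i e i + G\<^sup>2 / (3 B\<^sup>2)\<close> of
  \<open>iterate_distance_step\<close>, and summation yields \<open>weighted_gap_bound\<close>. Jensen's inequality
  transfers this bound to the averaged iterate. Its weights \<open>sqrt (i + 1)\<close> sum to at least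
  \<open>2/3 (k + 1)\<^sup>3\<^sup>/\<^sup>2\<close> (\<open>sum_sqrt_lower_bound\<close>), while the right-hand side grows linearly in
  \<open>k\<close>; together with \<open>sqrt 6 \<le> 8/3\<close> this gives the stated constants.

  The probabilistic ingredient is that \<open>x i\<close> is a function of the first \<open>i\<close> random inputs, so that
  the pair formed by \<open>x i\<close> and the next input has a product law (\<open>distr_iterate_fresh\<close>). Fubini's
  theorem then allows the oracle to be averaged at a frozen query point
  (\<open>integral_fresh_bound\<close>), which replaces conditional expectations.
\<close>

section \<open>Deterministic estimates\<close>

text \<open>
  The bound is the integral of the square root over \<open>[0, k + 1]\<close>. In the induction step, with
  \<open>a\<close> and \<open>b\<close> the square roots of consecutive numbers, \<open>(b - a) (b + a) = 1\<close> turns the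
  claim \<open>2 (b\<^sup>3 - a\<^sup>3) \<le> 3 b\<close> into \<open>2 a\<^sup>2 \<le> a b + b\<^sup>2\<close>.
\<close>

lemma sum_sqrt_lower_bound:
  "(\<Sum>i=0..k. sqrt (real i + 1)) \<ge> 2 / 3 * ((real k + 1) * sqrt (real k + 1))"
proof (induction k)
  case 0
  show ?case by simp
next
  case (Suc k)
  define a b where "a = sqrt (real k + 1)" and "b = sqrt (real k + 2)"
  have a2: "a\<^sup>2 = real k + 1" and b2: "b\<^sup>2 = real k + 2" and pos: "0 < a" "0 < b" and le: "a \<le> b"
    by (auto simp: a_def b_def)
  have "2 * a\<^sup>2 \<le> a * b + b\<^sup>2"
    using mult_left_mono[OF le less_imp_le[OF pos(1)]] power_mono[OF le less_imp_le[OF pos(1)], of 2]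
    by (simp add: power2_eq_square)
  then have "(b - a) * (2 * (a\<^sup>2 + a * b + b\<^sup>2)) \<le> (b - a) * (3 * b * (a + b))"
    using le by (intro mult_left_mono) (auto simp: power2_eq_square algebra_simps)
  also have "\<dots> = 3 * b * (b\<^sup>2 - a\<^sup>2)"
    by (simp add: power2_eq_square algebra_simps)
  also have "\<dots> = 3 * b"
    by (simp add: a2 b2)
  finally have "2 * (b\<^sup>2 * b) \<le> 2 * (a\<^sup>2 * a) + 3 * b"
    by (simp add: power2_eq_square algebra_simps)
  then have "2 / 3 * ((real k + 2) * b) \<le> 2 / 3 * ((real k + 1) * a) + b"
    by (simp add: a2 b2 mult.commute)
  moreover have "2 / 3 * ((real k + 1) * a) \<le> (\<Sum>i=0..k. sqrt (real i + 1))"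
    using Suc.IH by (simp add: a_def)
  moreover have "real (Suc k) + 1 = real k + 2"
    by simp
  ultimately show ?case
    unfolding sum.atLeast0_atMost_Suc by (simp only: b_def)
qed

text \<open>
  Young's inequality is applied to \<open>\<tau> v\<close> and \<open>\<beta> (x - u)\<close> with equal weights: this choice makes
  the coefficient of \<open>\<parallel>v\<parallel>\<^sup>2\<close> small enough for the final constant in front of \<open>G\<^sup>2\<close>. The remaining
  multiple of \<open>\<parallel>x - u\<parallel>\<^sup>2\<close> is kept, since it has to compensate the growth of the oracle.
\<close>

lemma anchored_step_distance:
  fixes u v x z :: "'a::euclidean_space"
  assumes X: "closed X" "convex X" and z: "z \<in> X"
  shows "(norm (closest_point X (\<beta> *\<^sub>R u + (1 - \<beta>) *\<^sub>R x - \<tau> *\<^sub>R v) - z))\<^sup>2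
    \<le> \<beta> * (norm (u - z))\<^sup>2 + (1 - \<beta>) * (norm (x - z))\<^sup>2
      - (\<beta> * (1 - \<beta>) - \<beta>\<^sup>2) * (norm (x - u))\<^sup>2 - 2 * \<tau> * (v \<bullet> (x - z)) + 2 * \<tau>\<^sup>2 * (norm v)\<^sup>2"
proof -
  let ?y = "\<beta> *\<^sub>R u + (1 - \<beta>) *\<^sub>R x - \<tau> *\<^sub>R v"
  have "dist (closest_point X ?y) (closest_point X z) \<le> dist ?y z"
    using X z by (intro closest_point_lipschitz) auto
  then have "(norm (closest_point X ?y - z))\<^sup>2 \<le> (norm (?y - z))\<^sup>2"
    using z by (auto simp: dist_norm closest_point_self intro!: power_mono)
  moreover have "(norm (?y - z))\<^sup>2 = \<beta> * (norm (u - z))\<^sup>2 + (1 - \<beta>) * (norm (x - z))\<^sup>2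
      - \<beta> * (1 - \<beta>) * (norm (x - u))\<^sup>2 - 2 * \<tau> * (v \<bullet> (x - z))
      + 2 * ((\<tau> *\<^sub>R v) \<bullet> (\<beta> *\<^sub>R (x - u))) + \<tau>\<^sup>2 * (norm v)\<^sup>2"
    unfolding power2_norm_eq_inner
    by (simp add: inner_add_left inner_add_right inner_diff_left inner_diff_right
        inner_commute algebra_simps power2_eq_square)
  moreover have "2 * ((\<tau> *\<^sub>R v) \<bullet> (\<beta> *\<^sub>R (x - u))) \<le> \<tau>\<^sup>2 * (norm v)\<^sup>2 + \<beta>\<^sup>2 * (norm (x - u))\<^sup>2"
    using inner_ge_zero[of "\<tau> *\<^sub>R v - \<beta> *\<^sub>R (x - u)"]
    unfolding power2_norm_eq_inner
    by (simp add: inner_diff_left inner_diff_right inner_commute algebra_simps power2_eq_square)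
  ultimately show ?thesis
    by (simp add: left_diff_distrib)
qed

lemma inner_le_half_squares:
  fixes a b :: "'a::real_inner"
  shows "\<bar>a \<bullet> b\<bar> \<le> ((norm a)\<^sup>2 + (norm b)\<^sup>2) / 2"
proof -
  have "\<bar>a \<bullet> b\<bar> \<le> norm a * norm b"
    by (rule Cauchy_Schwarz_ineq2)
  also have "\<dots> \<le> ((norm a)\<^sup>2 + (norm b)\<^sup>2) / 2"
    using sum_squares_bound[of "norm a" "norm b"] by simp
  finally show ?thesis .
qed

text \<open>
  The last inequality says that the pull towards the anchor dominates the growth of the oracle's
  second moment. With \<open>n = i + 2\<close> it reads \<open>(n - 1) / 3 \<le> n - 2\<close>, which is false for \<open>i = 0\<close>.
\<close>

lemma step_parameters:
  assumes "B > 0"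
  shows "(real i + 2) * step_size B i = sqrt (real i + 1) / (sqrt 6 * B)"
    and "(real i + 2) * anchor_weight i = 1"
    and "(real i + 2) * (1 - anchor_weight i) = real i + 1"
    and "(real i + 2) * (2 * (step_size B i)\<^sup>2) \<le> 1 / (3 * B\<^sup>2)"
    and "i \<ge> 1 \<Longrightarrow> 2 * (step_size B i)\<^sup>2 * B\<^sup>2
           \<le> anchor_weight i * (1 - anchor_weight i) - (anchor_weight i)\<^sup>2"
proof -
  have p: "real i + 2 > 0" by simp
  show "(real i + 2) * step_size B i = sqrt (real i + 1) / (sqrt 6 * B)"
    using p by (simp add: step_size_def)
  show "(real i + 2) * anchor_weight i = 1" 
    using p by (simp add: anchor_weight_def)
  then show "(real i + 2) * (1 - anchor_weight i) = real i + 1"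
    by (simp add: algebra_simps)
  have t: "(step_size B i)\<^sup>2 = (real i + 1) / (6 * B\<^sup>2 * (real i + 2)\<^sup>2)"
    by (simp add: step_size_def power_divide power_mult_distrib)
  have "(real i + 2) * (2 * (step_size B i)\<^sup>2) = (real i + 1) / (real i + 2) * (1 / (3 * B\<^sup>2))"
  proof -
    have "r * (2 * (q / (6 * B\<^sup>2 * r\<^sup>2))) = q / r * (1 / (3 * B\<^sup>2))" if "r > 0" for q r :: real
      using that assms by (simp add: field_simps power2_eq_square)
    then show ?thesis unfolding t using p by blast
  qed
  also have "\<dots> \<le> 1 * (1 / (3 * B\<^sup>2))"
    by (intro mult_right_mono) auto
  finally show "(real i + 2) * (2 * (step_size B i)\<^sup>2) \<le> 1 / (3 * B\<^sup>2)"
    by simp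
  assume i: "i \<ge> 1"
  have "2 * (q / (6 * B\<^sup>2 * r)) * B\<^sup>2 = (q / 3) / r" for q r :: real
    using assms by simp
  then have "2 * (step_size B i)\<^sup>2 * B\<^sup>2 = ((real i + 1) / 3) / (real i + 2)\<^sup>2"
    unfolding t .
  also have "\<dots> \<le> real i / (real i + 2)\<^sup>2"
    using i by (intro divide_right_mono) auto
  also have "\<dots> = (real i + 2 - 2) / (real i + 2)\<^sup>2"
    by simp
  also have "\<dots> = anchor_weight i * (1 - anchor_weight i) - (anchor_weight i)\<^sup>2"
  proof -
    have "(r - 2) / r\<^sup>2 = 1 / r * (1 - 1 / r) - (1 / r)\<^sup>2" if "r > 0" for r :: real
      using that by (simp add: field_simps power2_eq_square)
    then show ?thesis unfolding anchor_weight_def using p by blast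
  qed
  finally show "2 * (step_size B i)\<^sup>2 * B\<^sup>2
           \<le> anchor_weight i * (1 - anchor_weight i) - (anchor_weight i)\<^sup>2" .
qed

section \<open>The oracle at a fixed query point\<close>

lemma stochastic_oracle_moments:
  fixes g :: "'a::euclidean_space \<Rightarrow> 's \<Rightarrow> 'a"
  assumes "stochastic_oracle f x0 B G N g"
  shows "g x \<in> borel_measurable N"
    and "integrable N (g x)"
    and "integrable N (\<lambda>s. (norm (g x s))\<^sup>2)"
    and "(\<integral>s. (norm (g x s))\<^sup>2 \<partial>N) \<le> B\<^sup>2 * (norm (x - x0))\<^sup>2 + G\<^sup>2"
    and "f x + (\<integral>s. g x s \<partial>N) \<bullet> (y - x) \<le> f y"
proof -
  interpret N: prob_space N using assms by (simp add: stochastic_oracle_def)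
  have "(\<lambda>s. (\<lambda>(x, s). g x s) (x, s)) \<in> borel_measurable N"
    using assms unfolding stochastic_oracle_def
    by (intro measurable_compose[OF measurable_Pair1']) auto
  then show m[measurable]: "g x \<in> borel_measurable N" by simp
  have b: "(\<integral>\<^sup>+ s. ennreal ((norm (g x s))\<^sup>2) \<partial>N) \<le> ennreal (B\<^sup>2 * (norm (x - x0))\<^sup>2 + G\<^sup>2)"
    using assms by (simp add: stochastic_oracle_def)
  then show i: "integrable N (\<lambda>s. (norm (g x s))\<^sup>2)"
    by (intro integrableI_nonneg) (auto simp: le_less_trans)
  show "integrable N (g x)"
  proof (rule Bochner_Integration.integrable_bound[OF Bochner_Integration.integrable_add[OF N.integrable_const[of 1] i]])
    have "norm (g x s) \<le> norm (1 + (norm (g x s))\<^sup>2)" for s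
      using sum_squares_bound[of "norm (g x s)" 1] by (simp add: abs_of_nonneg)
         (smt (verit) norm_ge_zero zero_le_power2)
    then show "AE s in N. norm (g x s) \<le> norm (1 + (norm (g x s))\<^sup>2)" by simp
  qed (use N.emeasure_space_1 in auto)
  show "(\<integral>s. (norm (g x s))\<^sup>2 \<partial>N) \<le> B\<^sup>2 * (norm (x - x0))\<^sup>2 + G\<^sup>2"
    using b by (subst (asm) nn_integral_eq_integral[OF i]) (auto simp: ennreal_le_iff simp del: ennreal_plus)
  show "f x + (\<integral>s. g x s \<partial>N) \<bullet> (y - x) \<le> f y"
    using assms by (auto simp: stochastic_oracle_def subdifferential_def)
qed

text \<open>
  Only the second moment of the answer is controlled, so the mean is tested against \<open>y\<close> with
  the inequality between geometric and arithmetic mean under the integral.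
\<close>

lemma stochastic_oracle_mean_inner:
  fixes g :: "'a::euclidean_space \<Rightarrow> 's \<Rightarrow> 'a"
  assumes "stochastic_oracle f x0 B G N g"
  shows "\<bar>(\<integral>s. g x s \<partial>N) \<bullet> y\<bar> \<le> (B\<^sup>2 * (norm (x - x0))\<^sup>2 + G\<^sup>2 + (norm y)\<^sup>2) / 2"
proof -
  interpret N: prob_space N using assms by (simp add: stochastic_oracle_def)
  note o = stochastic_oracle_moments[OF assms]
  have "\<bar>(\<integral>s. g x s \<partial>N) \<bullet> y\<bar> = \<bar>\<integral>s. g x s \<bullet> y \<partial>N\<bar>"
    using o(2) by simp
  also have "\<dots> \<le> (\<integral>s. \<bar>g x s \<bullet> y\<bar> \<partial>N)"
    using integral_norm_bound[of N "\<lambda>s. g x s \<bullet> y"] by simp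
  also have "\<dots> \<le> (\<integral>s. ((norm (g x s))\<^sup>2 + (norm y)\<^sup>2) / 2 \<partial>N)"
    using o(2)[of x] o(3)[of x] by (intro integral_mono integrable_abs integrable_inner_left inner_le_half_squares) auto
  also have "\<dots> = ((\<integral>s. (norm (g x s))\<^sup>2 \<partial>N) + (norm y)\<^sup>2) / 2"
    using o(3)[of x] by (simp add: N.prob_space)
  also have "\<dots> \<le> (B\<^sup>2 * (norm (x - x0))\<^sup>2 + G\<^sup>2 + (norm y)\<^sup>2) / 2"
    using o(4)[of x] by simp
  finally show ?thesis .
qed

text \<open>
  The subgradient inequality at \<open>z\<close> bounds \<open>f y - f z\<close> from below, the one at \<open>y\<close> bounds it
  from above, and subgradients grow at most linearly. Hence \<open>f\<close> is integrable at every square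
  integrable random point.
\<close>

lemma stochastic_oracle_quadratic_growth:
  fixes f :: "'a::euclidean_space \<Rightarrow> real"
  assumes "stochastic_oracle f x0 B G N g"
  shows "\<bar>f y - f z\<bar> \<le> (2 * B\<^sup>2 * (norm (x0 - z))\<^sup>2 + G\<^sup>2 + (2 * B\<^sup>2 + 1) * (norm (y - z))\<^sup>2) / 2"
proof -
  note o = stochastic_oracle_moments(5)[OF assms] and i = stochastic_oracle_mean_inner[OF assms]
  define P Q where "P = B\<^sup>2 * (norm (x0 - z))\<^sup>2" and "Q = B\<^sup>2 * (norm (y - z))\<^sup>2"
  have "(norm (y - x0))\<^sup>2 + (norm (y - z + (x0 - z)))\<^sup>2 = 2 * (norm (y - z))\<^sup>2 + 2 * (norm (x0 - z))\<^sup>2"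
    unfolding power2_norm_eq_inner
    by (simp add: inner_add_left inner_add_right inner_diff_left inner_diff_right inner_commute)
  then have "(norm (y - x0))\<^sup>2 \<le> 2 * (norm (y - z))\<^sup>2 + 2 * (norm (x0 - z))\<^sup>2"
    by (smt (verit) zero_le_power2)
  then have "B\<^sup>2 * (norm (y - x0))\<^sup>2 \<le> B\<^sup>2 * (2 * (norm (y - z))\<^sup>2 + 2 * (norm (x0 - z))\<^sup>2)"
    by (intro mult_left_mono) auto
  also have "\<dots> = 2 * Q + 2 * P"
    by (simp add: P_def Q_def distrib_left)
  finally have "f y - f z \<le> (2 * P + 2 * Q + G\<^sup>2 + (norm (y - z))\<^sup>2) / 2"
    using o[of y z] i[of y "z - y"] norm_minus_commute[of z y] by simp
  moreover have "f z - f y \<le> (P + G\<^sup>2 + (norm (y - z))\<^sup>2) / 2"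
    using o[of z y] i[of z "y - z"] norm_minus_commute[of z x0] by (simp add: P_def)
  moreover have "0 \<le> P" "0 \<le> Q"
    by (simp_all add: P_def Q_def)
  ultimately have "\<bar>f y - f z\<bar> \<le> (2 * P + G\<^sup>2 + (2 * Q + (norm (y - z))\<^sup>2)) / 2"
    by (intro abs_leI) (simp_all add: field_simps)
  then show ?thesis
    by (simp add: P_def Q_def distrib_right)
qed

text \<open>
  The condition on the weights makes the coefficient of \<open>\<parallel>x - x0\<parallel>\<^sup>2\<close> nonpositive after
  averaging; the alternative \<open>x = x0\<close> is what the first iteration relies on. The estimate is
  stated as a nonnegative integral, ready for Fubini's theorem at a random query point, and
  therefore needs the nonnegativity of the bound as well.
\<close>

lemma expected_anchored_step:
  fixes g :: "'a::euclidean_space \<Rightarrow> 's \<Rightarrow> 'a"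
  assumes X: "closed X" "convex X" and z: "z \<in> X" and orc: "stochastic_oracle f x0 B G N g"
    and "\<tau> \<ge> 0"
    and weights: "2 * \<tau>\<^sup>2 * B\<^sup>2 \<le> \<beta> * (1 - \<beta>) - \<beta>\<^sup>2 \<or> x = x0"
  defines "\<psi> \<equiv> \<beta> * (norm (x0 - z))\<^sup>2 + (1 - \<beta>) * (norm (x - z))\<^sup>2
      - 2 * \<tau> * (f x - f z) + 2 * \<tau>\<^sup>2 * G\<^sup>2"
  shows "0 \<le> \<psi>" and "(\<integral>\<^sup>+ s. ennreal ((norm (closest_point X
            (\<beta> *\<^sub>R x0 + (1 - \<beta>) *\<^sub>R x - \<tau> *\<^sub>R g x s) - z))\<^sup>2) \<partial>N) \<le> ennreal \<psi>"
proof -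
  interpret N: prob_space N using orc by (simp add: stochastic_oracle_def)
  note o = stochastic_oracle_moments[OF orc]
  define w where "w = (\<integral>s. g x s \<partial>N)"
  define c where "c = \<beta> * (norm (x0 - z))\<^sup>2 + (1 - \<beta>) * (norm (x - z))\<^sup>2
      - (\<beta> * (1 - \<beta>) - \<beta>\<^sup>2) * (norm (x - x0))\<^sup>2"
  define h where "h = (\<lambda>s. c - 2 * \<tau> * (g x s \<bullet> (x - z)) + 2 * \<tau>\<^sup>2 * (norm (g x s))\<^sup>2)"
  let ?d = "\<lambda>s. (norm (closest_point X (\<beta> *\<^sub>R x0 + (1 - \<beta>) *\<^sub>R x - \<tau> *\<^sub>R g x s) - z))\<^sup>2"
  have d: "?d s \<le> h s" for s
    using anchored_step_distance[OF X z] by (simp add: h_def c_def)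
  then have h0: "0 \<le> h s" for s
    by (rule order_trans[rotated]) simp
  have ih: "integrable N h"
    unfolding h_def using o(2)[of x] o(3)[of x] by auto
  have "integral\<^sup>L N h = c - 2 * \<tau> * (w \<bullet> (x - z)) + 2 * \<tau>\<^sup>2 * (\<integral>s. (norm (g x s))\<^sup>2 \<partial>N)"
    unfolding h_def w_def using o(2)[of x] o(3)[of x] by (simp add: N.prob_space)
  also have "\<dots> \<le> c - 2 * \<tau> * (f x - f z) + 2 * \<tau>\<^sup>2 * (B\<^sup>2 * (norm (x - x0))\<^sup>2 + G\<^sup>2)"
  proof (intro add_mono diff_mono mult_left_mono)
    show "f x - f z \<le> w \<bullet> (x - z)"
      using o(5)[of x z] by (simp add: w_def inner_diff_right)
  qed (use o(4) \<open>\<tau> \<ge> 0\<close> in auto)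
  also have "\<dots> \<le> \<psi>"
  proof -
    have "2 * \<tau>\<^sup>2 * B\<^sup>2 * (norm (x - x0))\<^sup>2 \<le> (\<beta> * (1 - \<beta>) - \<beta>\<^sup>2) * (norm (x - x0))\<^sup>2"
      using weights by (auto intro: mult_right_mono)
    then show ?thesis by (simp add: \<psi>_def c_def algebra_simps)
  qed
  finally have le: "integral\<^sup>L N h \<le> \<psi>" .
  then show "0 \<le> \<psi>"
    using h0 by (smt (verit) integral_nonneg_AE AE_I2)
  have "(\<integral>\<^sup>+ s. ennreal (?d s) \<partial>N) \<le> (\<integral>\<^sup>+ s. ennreal (h s) \<partial>N)"
    by (intro nn_integral_mono ennreal_leI d)
  also have "\<dots> = ennreal (integral\<^sup>L N h)"
    using h0 by (intro nn_integral_eq_integral[OF ih]) auto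
  finally show "(\<integral>\<^sup>+ s. ennreal (?d s) \<partial>N) \<le> ennreal \<psi>"
    using le ennreal_leI order_trans by blast
qed

section \<open>Iterates and fresh randomness\<close>

text \<open>
  The two random inputs may live on different sample spaces: this allows passing from \<open>\<omega>\<close> to
  the tuple of the inputs used so far.
\<close>

lemma iterate_cong:
  assumes "\<And>i. i < k \<Longrightarrow> \<xi> i \<omega> = \<eta> i v"
  shows "iterate X B x0 g \<xi> k \<omega> = iterate X B x0 g \<eta> k v"
  using assms by (induction k) auto

lemma measurable_iterate:
  fixes X :: "'a::euclidean_space set"
  assumes X: "X \<noteq> {}" "closed X" "convex X"
    and g: "(\<lambda>(x, s). g x s) \<in> borel_measurable (borel \<Otimes>\<^sub>M N)"
    and "\<And>i. i < k \<Longrightarrow> \<xi> i \<in> measurable M N"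
  shows "iterate X B x0 g \<xi> k \<in> borel_measurable M"
  using assms(5)
proof (induction k)
  case 0
  have "iterate X B x0 g \<xi> 0 = (\<lambda>_. x0)" by (rule ext) simp
  then show ?case by simp
next
  case (Suc k)
  have x[measurable]: "iterate X B x0 g \<xi> k \<in> borel_measurable M"
    using Suc by simp
  have \<xi>[measurable]: "\<xi> k \<in> measurable M N" using Suc.prems by simp
  have c[measurable]: "closest_point X \<in> borel_measurable borel"
    using X by (intro borel_measurable_continuous_onI continuous_on_closest_point) auto
  have [measurable]: "(\<lambda>\<omega>. g (iterate X B x0 g \<xi> k \<omega>) (\<xi> k \<omega>)) \<in> borel_measurable M"
    using measurable_compose[OF measurable_Pair[OF x \<xi>] g] by simp
  have "iterate X B x0 g \<xi> (Suc k) = (\<lambda>\<omega>. closest_point X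
       (anchor_weight k *\<^sub>R x0 + (1 - anchor_weight k) *\<^sub>R iterate X B x0 g \<xi> k \<omega>
        - step_size B k *\<^sub>R g (iterate X B x0 g \<xi> k \<omega>) (\<xi> k \<omega>)))"
    by (rule ext) simp
  then show ?case by simp
qed

text \<open>
  The iterate is a measurable function \<open>h\<close> of the tuple of earlier inputs. Independence is known
  for the tuple of earlier inputs and the tuple consisting of the current one, two random
  elements of product spaces over the same index type. Their joint law is a product, and its
  image under \<open>h\<close> and the projection to the current input is the law in question.
\<close>

lemma distr_iterate_fresh:
  fixes X :: "'a::euclidean_space set" and N :: "'s measure"
  assumes X: "X \<noteq> {}" "closed X" "convex X"
    and g: "(\<lambda>(x, s). g x s) \<in> borel_measurable (borel \<Otimes>\<^sub>M N)"
    and "prob_space M" and fresh: "fresh_randomness M N \<xi>"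
  shows "distr M (borel \<Otimes>\<^sub>M N) (\<lambda>\<omega>. (iterate X B x0 g \<xi> k \<omega>, \<xi> k \<omega>))
    = distr M borel (iterate X B x0 g \<xi> k) \<Otimes>\<^sub>M N"
proof -
  interpret prob_space M by fact
  have indep: "indep_vars (\<lambda>_. N) \<xi> UNIV" and law: "distr M N (\<xi> k) = N"
    using fresh by (auto simp: fresh_randomness_def)
  have \<xi>[measurable]: "\<xi> i \<in> measurable M N" for i
    using indep by (auto simp: indep_vars_def)
  interpret N: prob_space N
    using prob_space_distr[OF \<xi>[of k]] law by simp
  let ?P = "PiM {..<k} (\<lambda>_. N)" and ?Q = "PiM {k} (\<lambda>_. N)"
  define V U where "V = (\<lambda>\<omega>. restrict (\<lambda>i. \<xi> i \<omega>) {..<k})" and "U = (\<lambda>\<omega>. restrict (\<lambda>i. \<xi> i \<omega>) {k})"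
  define h where "h = (\<lambda>v. iterate X B x0 g (\<lambda>i v. v i) k v)"
  have "indep_var ?P V ?Q U"
    unfolding V_def U_def by (rule indep_var_restrict[OF indep]) auto
  then have joint: "distr M (?P \<Otimes>\<^sub>M ?Q) (\<lambda>\<omega>. (V \<omega>, U \<omega>)) = distr M ?P V \<Otimes>\<^sub>M distr M ?Q U"
    by (simp add: indep_var_distribution_eq)
  have V[measurable]: "V \<in> measurable M ?P" and U[measurable]: "U \<in> measurable M ?Q"
    unfolding V_def U_def by measurable
  have h[measurable]: "h \<in> borel_measurable ?P"
    unfolding h_def using X g by (rule measurable_iterate) auto
  have p[measurable]: "(\<lambda>u. u k) \<in> measurable ?Q N"
    by simp
  have hV: "h (V \<omega>) = iterate X B x0 g \<xi> k \<omega>" and pU: "U \<omega> k = \<xi> k \<omega>" for \<omega>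
    by (auto simp: h_def V_def U_def intro!: iterate_cong)
  have "distr M (borel \<Otimes>\<^sub>M N) (\<lambda>\<omega>. (iterate X B x0 g \<xi> k \<omega>, \<xi> k \<omega>))
      = distr (distr M (?P \<Otimes>\<^sub>M ?Q) (\<lambda>\<omega>. (V \<omega>, U \<omega>))) (borel \<Otimes>\<^sub>M N) (\<lambda>(v, u). (h v, u k))"
    by (subst distr_distr) (auto simp: comp_def hV pU)
  also have "\<dots> = distr (distr M ?P V) borel h \<Otimes>\<^sub>M distr (distr M ?Q U) N (\<lambda>u. u k)"
  proof (subst pair_measure_distr)
    show "sigma_finite_measure (distr (distr M ?Q U) N (\<lambda>u. u k))"
      using law N.sigma_finite_measure_axioms by (simp add: distr_distr comp_def pU)
  qed (simp_all add: joint)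
  also have "\<dots> = distr M borel (iterate X B x0 g \<xi> k) \<Otimes>\<^sub>M N"
    by (simp add: distr_distr comp_def hV pU law)
  finally show ?thesis .
qed

text \<open>
  This plays the part of conditioning on the past: a bound for the average over the fresh input
  at each frozen value of \<open>x\<close> becomes a bound for the joint average. It is required only at values
  that \<open>x\<close> attains, because the first iteration satisfies it only at the anchor.
\<close>

lemma integral_fresh_bound:
  fixes \<phi> :: "'a::euclidean_space \<Rightarrow> 's \<Rightarrow> real" and N :: "'s measure"
  assumes "prob_space M" "prob_space N"
    and x[measurable]: "x \<in> borel_measurable M" and \<zeta>[measurable]: "\<zeta> \<in> measurable M N"
    and joint: "distr M (borel \<Otimes>\<^sub>M N) (\<lambda>\<omega>. (x \<omega>, \<zeta> \<omega>)) = distr M borel x \<Otimes>\<^sub>M N"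
    and \<phi>: "(\<lambda>(x, s). \<phi> x s) \<in> borel_measurable (borel \<Otimes>\<^sub>M N)" "\<And>x s. 0 \<le> \<phi> x s"
    and \<psi>: "integrable M (\<lambda>\<omega>. \<psi> (x \<omega>))" "\<And>\<omega>. 0 \<le> \<psi> (x \<omega>)"
    and bound: "\<And>\<omega>. (\<integral>\<^sup>+ s. ennreal (\<phi> (x \<omega>) s) \<partial>N) \<le> ennreal (\<psi> (x \<omega>))"
  shows "integrable M (\<lambda>\<omega>. \<phi> (x \<omega>) (\<zeta> \<omega>))"
    and "(\<integral>\<omega>. \<phi> (x \<omega>) (\<zeta> \<omega>) \<partial>M) \<le> (\<integral>\<omega>. \<psi> (x \<omega>) \<partial>M)"
proof -
  interpret M: prob_space M by fact
  interpret N: prob_space N by fact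
  have \<phi>': "(\<lambda>(x, s). ennreal (\<phi> x s)) \<in> borel_measurable (borel \<Otimes>\<^sub>M N)"
    using measurable_compose[OF \<phi>(1) measurable_ennreal] by (simp add: case_prod_beta)
  have m: "(\<lambda>\<omega>. \<phi> (x \<omega>) (\<zeta> \<omega>)) \<in> borel_measurable M"
    using measurable_compose[OF measurable_Pair[OF x \<zeta>] \<phi>(1)] by simp
  have "(\<integral>\<^sup>+ \<omega>. ennreal (\<phi> (x \<omega>) (\<zeta> \<omega>)) \<partial>M)
      = (\<integral>\<^sup>+ p. (case p of (x, s) \<Rightarrow> ennreal (\<phi> x s)) \<partial>distr M (borel \<Otimes>\<^sub>M N) (\<lambda>\<omega>. (x \<omega>, \<zeta> \<omega>)))"
    using \<phi>' by (subst nn_integral_distr) auto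
  also have "\<dots> = (\<integral>\<^sup>+ y. \<integral>\<^sup>+ s. ennreal (\<phi> y s) \<partial>N \<partial>distr M borel x)"
    unfolding joint using \<phi>' by (subst N.nn_integral_fst[symmetric]) (auto cong: measurable_cong_sets)
  also have "\<dots> = (\<integral>\<^sup>+ \<omega>. \<integral>\<^sup>+ s. ennreal (\<phi> (x \<omega>) s) \<partial>N \<partial>M)"
    using N.borel_measurable_nn_integral_fst[OF \<phi>'] by (subst nn_integral_distr) auto
  also have "\<dots> \<le> (\<integral>\<^sup>+ \<omega>. ennreal (\<psi> (x \<omega>)) \<partial>M)"
    by (intro nn_integral_mono bound)
  also have "\<dots> = ennreal (\<integral>\<omega>. \<psi> (x \<omega>) \<partial>M)"
    using \<psi> by (intro nn_integral_eq_integral) auto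
  finally have le: "(\<integral>\<^sup>+ \<omega>. ennreal (\<phi> (x \<omega>) (\<zeta> \<omega>)) \<partial>M) \<le> ennreal (\<integral>\<omega>. \<psi> (x \<omega>) \<partial>M)" .
  then show i: "integrable M (\<lambda>\<omega>. \<phi> (x \<omega>) (\<zeta> \<omega>))"
    using m \<phi>(2) by (intro integrableI_nonneg) (auto simp: le_less_trans)
  show "(\<integral>\<omega>. \<phi> (x \<omega>) (\<zeta> \<omega>) \<partial>M) \<le> (\<integral>\<omega>. \<psi> (x \<omega>) \<partial>M)"
    using le \<phi>(2) \<psi>(2) by (subst (asm) nn_integral_eq_integral[OF i]) (auto simp: ennreal_le_iff)
qed

section \<open>Recursion for the expected squared distance\<close>

lemma integrable_oracle_objective:
  fixes f :: "'a::euclidean_space \<Rightarrow> real"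
  assumes "prob_space M" "convex_on UNIV f" "stochastic_oracle f x0 B G N g"
    and x: "x \<in> borel_measurable M" and int: "integrable M (\<lambda>\<omega>. (norm (x \<omega> - z))\<^sup>2)"
  shows "integrable M (\<lambda>\<omega>. f (x \<omega>) - f z)"
proof -
  interpret prob_space M by fact
  have [measurable]: "f \<in> borel_measurable borel"
    using convex_on_continuous[of UNIV f] assms(2) by (auto intro: borel_measurable_continuous_onI)
  let ?b = "\<lambda>\<omega>. (2 * B\<^sup>2 * (norm (x0 - z))\<^sup>2 + G\<^sup>2 + (2 * B\<^sup>2 + 1) * (norm (x \<omega> - z))\<^sup>2) / 2"
  show ?thesis
  proof (rule Bochner_Integration.integrable_bound)
    show "integrable M ?b" using int by auto
    show "(\<lambda>\<omega>. f (x \<omega>) - f z) \<in> borel_measurable M" using x by simp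
    show "AE \<omega> in M. norm (f (x \<omega>) - f z) \<le> norm (?b \<omega>)"
      by (rule AE_I2) (metis abs_ge_self order_trans real_norm_def
          stochastic_oracle_quadratic_growth[OF assms(3)])
  qed
qed

lemma iterate_distance_step:
  fixes X :: "'a::euclidean_space set" and f :: "'a \<Rightarrow> real"
  assumes X: "X \<noteq> {}" "closed X" "convex X" and f: "convex_on UNIV f" and z: "z \<in> X" and B: "B > 0"
    and orc: "stochastic_oracle f x0 B G N g"
    and M: "prob_space M" and fresh: "fresh_randomness M N \<xi>"
    and int: "integrable M (\<lambda>\<omega>. (norm (iterate X B x0 g \<xi> k \<omega> - z))\<^sup>2)"
  shows "integrable M (\<lambda>\<omega>. (norm (iterate X B x0 g \<xi> (Suc k) \<omega> - z))\<^sup>2)"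
    and "(real k + 2) * (\<integral>\<omega>. (norm (iterate X B x0 g \<xi> (Suc k) \<omega> - z))\<^sup>2 \<partial>M)
      \<le> (norm (x0 - z))\<^sup>2 + (real k + 1) * (\<integral>\<omega>. (norm (iterate X B x0 g \<xi> k \<omega> - z))\<^sup>2 \<partial>M)
        - 2 * ((real k + 2) * step_size B k) * (\<integral>\<omega>. f (iterate X B x0 g \<xi> k \<omega>) - f z \<partial>M)
        + G\<^sup>2 / (3 * B\<^sup>2)"
proof -
  interpret M: prob_space M by fact
  interpret N: prob_space N using orc by (simp add: stochastic_oracle_def)
  have g: "(\<lambda>(x, s). g x s) \<in> borel_measurable (borel \<Otimes>\<^sub>M N)"
    using orc by (simp add: stochastic_oracle_def)
  have indep: "M.indep_vars (\<lambda>_. N) \<xi> UNIV"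
    using fresh by (auto simp: fresh_randomness_def)
  define \<beta> \<tau> where "\<beta> = anchor_weight k" and "\<tau> = step_size B k"
  define x where "x = iterate X B x0 g \<xi> k"
  define \<phi> where "\<phi> = (\<lambda>x s. (norm (closest_point X (\<beta> *\<^sub>R x0 + (1 - \<beta>) *\<^sub>R x - \<tau> *\<^sub>R g x s) - z))\<^sup>2)"
  define \<psi> where "\<psi> = (\<lambda>x. \<beta> * (norm (x0 - z))\<^sup>2 + (1 - \<beta>) * (norm (x - z))\<^sup>2
      - 2 * \<tau> * (f x - f z) + 2 * \<tau>\<^sup>2 * G\<^sup>2)"
  note par = step_parameters[OF B, of k, folded \<beta>_def \<tau>_def]
  have x: "x \<in> borel_measurable M"
    unfolding x_def using X g indep by (intro measurable_iterate) (auto simp: M.indep_vars_def)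
  have intf: "integrable M (\<lambda>\<omega>. f (x \<omega>) - f z)" and intd: "integrable M (\<lambda>\<omega>. (norm (x \<omega> - z))\<^sup>2)"
    using integrable_oracle_objective[OF M f orc x, of z] int by (auto simp: x_def)
  have \<xi>: "\<xi> k \<in> measurable M N"
    using indep by (auto simp: M.indep_vars_def)
  have joint: "distr M (borel \<Otimes>\<^sub>M N) (\<lambda>\<omega>. (x \<omega>, \<xi> k \<omega>)) = distr M borel x \<Otimes>\<^sub>M N"
    unfolding x_def using X g M fresh by (rule distr_iterate_fresh)
  have c: "closest_point X \<in> borel_measurable borel"
    using X by (intro borel_measurable_continuous_onI continuous_on_closest_point) auto
  have \<phi>m: "(\<lambda>(x, s). \<phi> x s) \<in> borel_measurable (borel \<Otimes>\<^sub>M N)"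
  proof -
    note [measurable] = c g[unfolded case_prod_beta]
    show ?thesis unfolding \<phi>_def case_prod_beta by measurable
  qed
  have "\<tau> \<ge> 0" using B by (simp add: \<tau>_def step_size_def)
  \<comment> \<open>The weight inequality fails for \<open>k = 0\<close>, but then the iterate is the anchor.\<close>
  have w: "2 * \<tau>\<^sup>2 * B\<^sup>2 \<le> \<beta> * (1 - \<beta>) - \<beta>\<^sup>2 \<or> x \<omega> = x0" for \<omega>
  proof (cases "k = 0")
    case True
    then show ?thesis by (simp add: x_def)
  next
    case False
    then show ?thesis using par(5) by simp
  qed
  note step = expected_anchored_step[OF X(2,3) z orc \<open>\<tau> \<ge> 0\<close> w]
  have i\<psi>: "integrable M (\<lambda>\<omega>. \<psi> (x \<omega>))"
    unfolding \<psi>_def using intf intd by auto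
  have res: "integrable M (\<lambda>\<omega>. \<phi> (x \<omega>) (\<xi> k \<omega>))"
      "(\<integral>\<omega>. \<phi> (x \<omega>) (\<xi> k \<omega>) \<partial>M) \<le> (\<integral>\<omega>. \<psi> (x \<omega>) \<partial>M)"
    using integral_fresh_bound[OF M N.prob_space_axioms x \<xi> joint \<phi>m, of \<psi>] i\<psi> step
    by (auto simp: \<phi>_def \<psi>_def)
  have eq: "\<phi> (x \<omega>) (\<xi> k \<omega>) = (norm (iterate X B x0 g \<xi> (Suc k) \<omega> - z))\<^sup>2" for \<omega>
    by (simp add: \<phi>_def x_def \<beta>_def \<tau>_def)
  show "integrable M (\<lambda>\<omega>. (norm (iterate X B x0 g \<xi> (Suc k) \<omega> - z))\<^sup>2)"
    using res(1) unfolding eq .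
  let ?D = "(norm (x0 - z))\<^sup>2" and ?a = "\<integral>\<omega>. (norm (x \<omega> - z))\<^sup>2 \<partial>M"
    and ?e = "\<integral>\<omega>. f (x \<omega>) - f z \<partial>M"
  have "(\<integral>\<omega>. \<psi> (x \<omega>) \<partial>M) = \<beta> * ?D + (1 - \<beta>) * ?a - 2 * \<tau> * ?e + 2 * \<tau>\<^sup>2 * G\<^sup>2"
  proof -
    define F where "F = (\<lambda>\<omega>. f (x \<omega>) - f z)"
    have "(\<integral>\<omega>. \<beta> * ?D + (1 - \<beta>) * (norm (x \<omega> - z))\<^sup>2 - 2 * \<tau> * F \<omega> + 2 * \<tau>\<^sup>2 * G\<^sup>2 \<partial>M)
        = \<beta> * ?D + (1 - \<beta>) * ?a - 2 * \<tau> * integral\<^sup>L M F + 2 * \<tau>\<^sup>2 * G\<^sup>2"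
      using intd intf[folded F_def] by (simp add: M.prob_space)
    then show ?thesis by (simp add: \<psi>_def F_def)
  qed
  then have "(real k + 2) * (\<integral>\<omega>. \<phi> (x \<omega>) (\<xi> k \<omega>) \<partial>M)
      \<le> (real k + 2) * (\<beta> * ?D + (1 - \<beta>) * ?a - 2 * \<tau> * ?e + 2 * \<tau>\<^sup>2 * G\<^sup>2)"
    using res(2) by (intro mult_left_mono) auto
  also have "\<dots> = ((real k + 2) * \<beta>) * ?D + ((real k + 2) * (1 - \<beta>)) * ?a
      - 2 * ((real k + 2) * \<tau>) * ?e + ((real k + 2) * (2 * \<tau>\<^sup>2)) * G\<^sup>2"
    by (simp only: algebra_simps)
  also have "\<dots> \<le> ?D + (real k + 1) * ?a - 2 * ((real k + 2) * \<tau>) * ?e + 1 / (3 * B\<^sup>2) * G\<^sup>2"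
    unfolding par(2,3) using par(4) by (intro add_mono mult_right_mono) auto
  finally show "(real k + 2) * (\<integral>\<omega>. (norm (iterate X B x0 g \<xi> (Suc k) \<omega> - z))\<^sup>2 \<partial>M)
      \<le> (norm (x0 - z))\<^sup>2 + (real k + 1) * (\<integral>\<omega>. (norm (iterate X B x0 g \<xi> k \<omega> - z))\<^sup>2 \<partial>M)
        - 2 * ((real k + 2) * step_size B k) * (\<integral>\<omega>. f (iterate X B x0 g \<xi> k \<omega>) - f z \<partial>M)
        + G\<^sup>2 / (3 * B\<^sup>2)"
    unfolding eq by (simp add: x_def \<tau>_def)
qed

text \<open>
  The initial point is deterministic and each step preserves square integrability.
\<close>

lemma iterate_square_integrable:
  fixes X :: "'a::euclidean_space set" and f :: "'a \<Rightarrow> real"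
  assumes "X \<noteq> {}" "closed X" "convex X" "convex_on UNIV f" "z \<in> X" "B > 0"
    "stochastic_oracle f x0 B G N g" "prob_space M" "fresh_randomness M N \<xi>"
  shows "integrable M (\<lambda>\<omega>. (norm (iterate X B x0 g \<xi> k \<omega> - z))\<^sup>2)"
proof (induction k)
  case 0
  interpret prob_space M by fact
  show ?case by simp
next
  case (Suc k)
  then show ?case by (rule iterate_distance_step(1)[OF assms])
qed

text \<open>
  Summation of the recursion: \<open>D\<close> is collected once per step and once more from the start, because
  the first iterate has squared distance \<open>D\<close> and coefficient \<open>1\<close>. The gaps need not be nonnegative, as
  \<open>x0\<close> may lie outside \<open>X\<close>.
\<close>

lemma weighted_gap_bound:
  fixes X :: "'a::euclidean_space set" and f :: "'a \<Rightarrow> real"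
  assumes "X \<noteq> {}" "closed X" "convex X" "convex_on UNIV f" "z \<in> X" "B > 0"
    "stochastic_oracle f x0 B G N g" "prob_space M" "fresh_randomness M N \<xi>"
  shows "2 * (\<Sum>i=0..k. (real i + 2) * step_size B i * (\<integral>\<omega>. f (iterate X B x0 g \<xi> i \<omega>) - f z \<partial>M))
    \<le> (real k + 2) * (norm (x0 - z))\<^sup>2 + (real k + 1) * (G\<^sup>2 / (3 * B\<^sup>2))"
proof -
  interpret prob_space M by fact
  define a e where "a i = (\<integral>\<omega>. (norm (iterate X B x0 g \<xi> i \<omega> - z))\<^sup>2 \<partial>M)"
    and "e i = (\<integral>\<omega>. f (iterate X B x0 g \<xi> i \<omega>) - f z \<partial>M)" for i
  define D C where "D = (norm (x0 - z))\<^sup>2" and "C = G\<^sup>2 / (3 * B\<^sup>2)"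
  define c where "c i = (real i + 2) * step_size B i" for i
  have step: "(real i + 2) * a (Suc i) \<le> D + (real i + 1) * a i - 2 * c i * e i + C" for i
    unfolding a_def e_def c_def D_def C_def
    by (rule iterate_distance_step(2)[OF assms iterate_square_integrable[OF assms]])
  have "a 0 = D" by (simp add: a_def D_def prob_space)
  have "(real k + 2) * a (Suc k) + 2 * (\<Sum>i=0..k. c i * e i) \<le> (real k + 2) * D + (real k + 1) * C"
  proof (induction k)
    case 0
    show ?case using step[of 0] \<open>a 0 = D\<close> by simp
  next
    case (Suc k)
    show ?case using step[of "Suc k"] Suc by (simp add: algebra_simps)
  qed
  moreover have "0 \<le> (real k + 2) * a (Suc k)"
    by (simp add: a_def)
  ultimately show ?thesis by (simp add: e_def c_def D_def C_def)
qed

section \<open>Rate for the averaged iterate\<close>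

lemma integrable_between:
  fixes h :: "'w \<Rightarrow> real"
  assumes "h \<in> borel_measurable M" "integrable M l" "integrable M u"
    and "\<And>\<omega>. l \<omega> \<le> h \<omega>" "\<And>\<omega>. h \<omega> \<le> u \<omega>"
  shows "integrable M h"
proof (rule Bochner_Integration.integrable_bound)
  show "integrable M (\<lambda>\<omega>. \<bar>l \<omega>\<bar> + \<bar>u \<omega>\<bar>)" using assms by auto
  show "AE \<omega> in M. norm (h \<omega>) \<le> norm (\<bar>l \<omega>\<bar> + \<bar>u \<omega>\<bar>)"
    using assms(4,5) by (intro AE_I2) (smt (verit) real_norm_def)
qed fact

text \<open>
  Both constants come from \<open>sqrt 6 \<le> 8/3\<close>. The assumption \<open>k \<ge> 1\<close> enters through
  \<open>k + 2 \<le> 3/2 (k + 1)\<close>.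
\<close>

lemma rate_arithmetic:
  assumes B: "B > 0" and k: "k \<ge> (1::nat)" and D: "D \<ge> 0" and S: "S \<ge> 2 / 3 * ((real k + 1) * sqrt (real k + 1))"
    and E: "2 * (S / (sqrt 6 * B) * E) \<le> (real k + 2) * D + (real k + 1) * (G\<^sup>2 / (3 * B\<^sup>2))"
  shows "E \<le> 1 / sqrt (real k + 1) * (3 * B * D + 2 * G\<^sup>2 / (3 * B))"
proof -
  define n where "n = real k + 1"
  have n: "n \<ge> 2" using k by (simp add: n_def mult.assoc)
  have r: "sqrt n > 0" using n by simp
  have s6: "sqrt 6 \<le> 8 / (3::real)" by (rule real_le_lsqrt) (auto simp: power2_eq_square)
  have S0: "S > 0"
    using S n r by (smt (verit) mult_pos_pos n_def divide_pos_pos)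
  have "real k + 2 \<le> n * (3 / 2)" using k by (simp add: n_def)
  then have "(real k + 2) * D \<le> n * (3 / 2) * D" by (intro mult_right_mono D)
  then have "(real k + 2) * D \<le> n * (3 / 2 * D)" by (simp only: mult.assoc)
  moreover have "2 * (S / (sqrt 6 * B) * E) \<le> (real k + 2) * D + n * (G\<^sup>2 / (3 * B\<^sup>2))"
    using E by (simp only: n_def)
  ultimately have "2 * (S / (sqrt 6 * B) * E) \<le> n * (3 / 2 * D + G\<^sup>2 / (3 * B\<^sup>2))"
    unfolding distrib_left by linarith
  then have "S * E \<le> sqrt 6 * (B / 2 * (n * (3 / 2 * D + G\<^sup>2 / (3 * B\<^sup>2))))"
    using B by (simp add: field_simps)
  also have "\<dots> \<le> 8 / 3 * (B / 2 * (n * (3 / 2 * D + G\<^sup>2 / (3 * B\<^sup>2))))"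
    using B n D by (intro mult_right_mono s6) auto
  also have "\<dots> = 2 / 3 * n * (3 * B * D + 2 * G\<^sup>2 / (3 * B))"
    using B by (simp add: field_simps power2_eq_square)
  also have "\<dots> = 2 / 3 * (n * sqrt n) * (1 / sqrt n * (3 * B * D + 2 * G\<^sup>2 / (3 * B)))"
    using r by simp
  also have "\<dots> \<le> S * (1 / sqrt n * (3 * B * D + 2 * G\<^sup>2 / (3 * B)))"
    using S r B D by (intro mult_right_mono) (auto simp: n_def)
  finally show ?thesis
    using S0 unfolding n_def by (rule mult_left_le_imp_le)
qed

theorem corollary3p4:
  fixes X :: "'a::euclidean_space set"
    and f :: "'a \<Rightarrow> real"
    and x0 xstar :: 'a
    and B G :: real
    and N :: "'s measure"
    and g :: "'a \<Rightarrow> 's \<Rightarrow> 'a"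
    and M :: "'w measure"
    and \<xi> :: "nat \<Rightarrow> 'w \<Rightarrow> 's"
    and k :: nat
  assumes "X \<noteq> {}" and "closed X" and "convex X"
    and "convex_on UNIV f"
    and "is_arg_min f (\<lambda>x. x \<in> X) xstar"
    and "B > 0" and "G \<ge> 0"
    and "stochastic_oracle f x0 B G N g"
    and "prob_space M"
    and "fresh_randomness M N \<xi>"
    and "k \<ge> 1"
  shows "(\<forall>\<omega>. output_point X B x0 g \<xi> k \<omega> =
            (1 / (\<Sum>i=0..k. sqrt (real i + 1))) *\<^sub>R
              (\<Sum>i=0..k. sqrt (real i + 1) *\<^sub>R iterate X B x0 g \<xi> i \<omega>))
       \<and> integrable M (\<lambda>\<omega>. f (output_point X B x0 g \<xi> k \<omega>) - f xstar)
       \<and> (\<integral>\<omega>. (f (output_point X B x0 g \<xi> k \<omega>) - f xstar) \<partial>M)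
           \<le> 1 / sqrt (real k + 1) * (3 * B * (norm (x0 - xstar))\<^sup>2 + 2 * G\<^sup>2 / (3 * B))"
proof -
  interpret prob_space M by fact
  note geom = \<open>X \<noteq> {}\<close> \<open>closed X\<close> \<open>convex X\<close> \<open>convex_on UNIV f\<close>
  have z: "xstar \<in> X" using \<open>is_arg_min f (\<lambda>x. x \<in> X) xstar\<close> by (simp add: is_arg_min_def)
  note run = geom z \<open>B > 0\<close> \<open>stochastic_oracle f x0 B G N g\<close> \<open>prob_space M\<close> \<open>fresh_randomness M N \<xi>\<close>
  define x where "x i = iterate X B x0 g \<xi> i" for i
  define y where "y = output_point X B x0 g \<xi> k"
  define S where "S = (\<Sum>i=0..k. sqrt (real i + 1))"
  define e where "e i = (\<integral>\<omega>. f (x i \<omega>) - f xstar \<partial>M)" for i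
  define w where "w = (\<integral>s. g xstar s \<partial>N)"
  have "0 < 2 / 3 * ((real k + 1) * sqrt (real k + 1))" by simp
  then have S: "S \<ge> 2 / 3 * ((real k + 1) * sqrt (real k + 1))" "S > 0"
    using sum_sqrt_lower_bound[of k] unfolding S_def by linarith+
  have y: "y \<omega> = (1 / S) *\<^sub>R (\<Sum>i=0..k. sqrt (real i + 1) *\<^sub>R x i \<omega>)" for \<omega>
  proof -
    let ?c = "sqrt 6 * B"
    have "?c > 0" using \<open>B > 0\<close> by simp
    have "y \<omega> = (1 / (S / ?c)) *\<^sub>R (\<Sum>i=0..k. (sqrt (real i + 1) / ?c) *\<^sub>R x i \<omega>)"
      by (simp only: y_def output_point_def step_parameters(1)[OF \<open>B > 0\<close>] S_def x_def
          sum_divide_distrib)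
    also have "(\<Sum>i=0..k. (sqrt (real i + 1) / ?c) *\<^sub>R x i \<omega>)
        = (1 / ?c) *\<^sub>R (\<Sum>i=0..k. sqrt (real i + 1) *\<^sub>R x i \<omega>)"
      by (simp add: scaleR_sum_right)
    finally show ?thesis using \<open>B > 0\<close> by simp
  qed
  have fm[measurable]: "f \<in> borel_measurable borel"
    using convex_on_continuous[of UNIV f] geom(4) by (auto intro: borel_measurable_continuous_onI)
  have xm[measurable]: "x i \<in> borel_measurable M" for i
    unfolding x_def using run(7,9)
    by (intro measurable_iterate[OF geom(1-3), where N = N])
      (auto simp: stochastic_oracle_def fresh_randomness_def indep_vars_def)
  have sq: "integrable M (\<lambda>\<omega>. (norm (x i \<omega> - xstar))\<^sup>2)" for i
    unfolding x_def by (rule iterate_square_integrable[OF run])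
  have gap: "integrable M (\<lambda>\<omega>. f (x i \<omega>) - f xstar)" for i
    by (rule integrable_oracle_objective[OF run(8,4,7) xm sq])
  have ix: "integrable M (x i)" for i
  proof -
    have "integrable M (\<lambda>\<omega>. x i \<omega> - xstar)"
    proof (rule Bochner_Integration.integrable_bound)
      show "integrable M (\<lambda>\<omega>. 1 + (norm (x i \<omega> - xstar))\<^sup>2)" using sq by auto
      \<comment> \<open>On a probability space the square dominates the norm up to a constant.\<close>
      have "norm v \<le> norm (1 + (norm v)\<^sup>2)" for v :: 'a
        using sum_squares_bound[of "norm v" 1] by (smt (verit) norm_ge_zero zero_le_power2
            real_norm_def power_one mult_1_right)
      then show "AE \<omega> in M. norm (x i \<omega> - xstar) \<le> norm (1 + (norm (x i \<omega> - xstar))\<^sup>2)"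
        by simp
    qed simp
    then have "integrable M (\<lambda>\<omega>. (x i \<omega> - xstar) + xstar)"
      by (intro Bochner_Integration.integrable_add) auto
    then show ?thesis by simp
  qed
  have iy: "integrable M y"
  proof -
    have "integrable M (\<lambda>\<omega>. (1 / S) *\<^sub>R (\<Sum>i=0..k. sqrt (real i + 1) *\<^sub>R x i \<omega>))"
      using ix by (intro integrable_scaleR_right Bochner_Integration.integrable_sum) auto
    then show ?thesis by (simp add: y[abs_def] y fun_eq_iff cong: Bochner_Integration.integrable_cong)
  qed
  let ?u = "\<lambda>\<omega>. \<Sum>i=0..k. sqrt (real i + 1) / S * (f (x i \<omega>) - f xstar)"
  have jensen: "f (y \<omega>) - f xstar \<le> ?u \<omega>" for \<omega>
  proof -
    have one: "(\<Sum>i=0..k. sqrt (real i + 1) / S) = 1"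
      using S(2) by (simp add: sum_divide_distrib[symmetric] S_def)
    have "y \<omega> = (\<Sum>i=0..k. (sqrt (real i + 1) / S) *\<^sub>R x i \<omega>)"
      by (simp add: y scaleR_sum_right)
    then have "f (y \<omega>) \<le> (\<Sum>i=0..k. sqrt (real i + 1) / S * f (x i \<omega>))"
      using convex_on_sum[OF _ _ geom(4) one, of "\<lambda>i. x i \<omega>"] S(2) by auto
    moreover have "f xstar = (\<Sum>i=0..k. sqrt (real i + 1) / S * f xstar)"
      by (simp only: sum_distrib_right[symmetric] one mult_1_left)
    ultimately show ?thesis
      by (simp add: right_diff_distrib sum_subtractf)
  qed
  have iu: "integrable M ?u"
    using gap by (intro Bochner_Integration.integrable_sum integrable_mult_right) auto
  \<comment> \<open>The output need not lie in \<open>X\<close>, so the gap can be negative; a supporting affine function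
    at \<open>xstar\<close> bounds it from below.\<close>
  have int: "integrable M (\<lambda>\<omega>. f (y \<omega>) - f xstar)"
  proof (rule integrable_between[OF _ _ iu _ jensen])
    show "(\<lambda>\<omega>. f (y \<omega>) - f xstar) \<in> borel_measurable M" using iy by simp
    show "integrable M (\<lambda>\<omega>. w \<bullet> (y \<omega> - xstar))" using iy by auto
    show "w \<bullet> (y \<omega> - xstar) \<le> f (y \<omega>) - f xstar" for \<omega>
      using stochastic_oracle_moments(5)[OF run(7), of xstar "y \<omega>"] by (simp add: w_def)
  qed
  let ?E = "\<integral>\<omega>. f (y \<omega>) - f xstar \<partial>M"
  have "?E \<le> (\<integral>\<omega>. ?u \<omega> \<partial>M)"
    by (rule integral_mono[OF int iu jensen])
  also have "\<dots> = (\<Sum>i=0..k. sqrt (real i + 1) / S * e i)"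
    using gap by (subst Bochner_Integration.integral_sum) (auto simp: e_def)
  also have "\<dots> = (\<Sum>i=0..k. sqrt (real i + 1) * e i) / S"
    by (simp add: sum_divide_distrib)
  finally have "S * ?E \<le> (\<Sum>i=0..k. sqrt (real i + 1) * e i)"
    using S(2) by (simp add: field_simps)
  then have "S * ?E / (sqrt 6 * B) \<le> (\<Sum>i=0..k. sqrt (real i + 1) * e i) / (sqrt 6 * B)"
    using \<open>B > 0\<close> by (intro divide_right_mono) auto
  also have "\<dots> = (\<Sum>i=0..k. (real i + 2) * step_size B i * e i)"
    by (simp add: step_parameters(1)[OF \<open>B > 0\<close>] sum_divide_distrib)
  finally have "2 * (S / (sqrt 6 * B) * ?E)
      \<le> (real k + 2) * (norm (x0 - xstar))\<^sup>2 + (real k + 1) * (G\<^sup>2 / (3 * B\<^sup>2))"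
    using weighted_gap_bound[OF run, of k] by (simp add: e_def x_def)
  then have "?E \<le> 1 / sqrt (real k + 1) * (3 * B * (norm (x0 - xstar))\<^sup>2 + 2 * G\<^sup>2 / (3 * B))"
    using \<open>B > 0\<close> \<open>k \<ge> 1\<close> S(1) by (intro rate_arithmetic[of B k _ S]) auto
  then show ?thesis
    using y int by (simp add: y_def x_def S_def)
qed

end
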